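(* If $m+k\ge n$, then the following expansion holds: $$\frac{(1+x)^n}{(1-x)^{k+1}}=\sum_{m=m_0}^{\infty}\binom{m+k-n,\,n}{k}x^m,$$ where $m_0=\max\{0,n-k\}$.
   Context: Here $m,n,k$ denote nonnegative integers. For nonnegative integers $m,n,k$, let $X$ be a set consisting of pairwise disjoint blocks $X_1,\dots,X_n,Y$ with $|X_i|=2$ for $i=1,\dots,n$ and $|Y|=m$. The number $\binom{m,\,n}{k}$ is defined as the number of $(n+k)$-element subsets of $X$ that intersect each block $X_i$, $i=1,\dots,n$ (such subsets are called $(n+k)$-insets of $X$). In the expansion, $\binom{m+k-n,\,n}{k}$ is this number with $m+k-n$ in place of $m$. The expansion is the ordinary generating function for these numbers with respect to $m$, with $n$ and $k$ constant.
   Formalization: For n > k the displayed equality fails (the left side has constant term 1, the right side starts at x^(n-k)); the equality is proved for n ≤ k, and for all n, k the coefficients with m+k ≥ n agree, i.e. it holds after adding the left side's terms of degree below m_0. *)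

theory Defs
  imports "HOL-Computational_Algebra.Formal_Power_Series" "HOL-Library.Disjoint_Sets"
begin

definition block_system :: "nat \<Rightarrow> nat \<Rightarrow> (nat \<Rightarrow> 'a set) \<Rightarrow> 'a set \<Rightarrow> bool" where
  "block_system m n B Y \<longleftrightarrow>
     (\<forall>i\<in>{1..n}. card (B i) = 2) \<and> finite Y \<and> card Y = m \<and>
     disjoint_family_on B {1..n} \<and> (\<forall>i\<in>{1..n}. B i \<inter> Y = {})"

definition insets :: "nat \<Rightarrow> nat \<Rightarrow> (nat \<Rightarrow> 'a set) \<Rightarrow> 'a set \<Rightarrow> 'a set set" where
  "insets n k B Y =
     {A. A \<subseteq> (\<Union>i\<in>{1..n}. B i) \<union> Y \<and> card A = n + k \<and> (\<forall>i\<in>{1..n}. A \<inter> B i \<noteq> {})}"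

(* The number is defined through one fixed block system; by inset_number_eq below,
   every other block system with the same parameters gives the same value. *)

definition std_block :: "nat \<Rightarrow> (nat \<times> bool + nat) set" where
  "std_block i = Inl ` ({i} \<times> UNIV)"

definition std_rest :: "nat \<Rightarrow> (nat \<times> bool + nat) set" where
  "std_rest m = Inr ` {..<m}"

definition inset_number :: "nat \<Rightarrow> nat \<Rightarrow> nat \<Rightarrow> nat" where
  "inset_number m n k = card (insets n k std_block (std_rest m))"

lemma block_system_std: "block_system m n std_block (std_rest m)"
  by (auto simp: block_system_def std_block_def std_rest_def disjoint_family_on_def
      card_image card_cartesian_product)

lemma block_system_bij:
  assumes "block_system m n B Y" and "block_system m n C Z"
  obtains f where "bij_betw f ((\<Union>i\<in>{1..n}. B i) \<union> Y) ((\<Union>i\<in>{1..n}. C i) \<union> Z)"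
    and "\<And>i. i \<in> {1..n} \<Longrightarrow> f ` B i = C i"
proof -
  have "\<exists>g. bij_betw g (B i) (C i)" if "i \<in> {1..n}" for i
  proof (rule finite_same_card_bij)
    have c: "card (B i) = 2" "card (C i) = 2"
      using assms that unfolding block_system_def by blast+
    show "finite (B i)" "finite (C i)"
      by (rule card_ge_0_finite, unfold c, rule zero_less_numeral)+
    show "card (B i) = card (C i)" unfolding c ..
  qed
  then obtain g where g: "\<And>i. i \<in> {1..n} \<Longrightarrow> bij_betw (g i) (B i) (C i)" by metis
  obtain h where h: "bij_betw h Y Z"
    using assms finite_same_card_bij[of Y Z] unfolding block_system_def by auto
  define f where "f x = (if x \<in> Y then h x else g (THE i. i \<in> {1..n} \<and> x \<in> B i) x)" for x
  have fB: "f x = g i x" if "i \<in> {1..n}" "x \<in> B i" for i x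
  proof -
    have "x \<notin> Y" using assms(1) that by (auto simp: block_system_def)
    moreover have "(THE j. j \<in> {1..n} \<and> x \<in> B j) = i"
    proof (rule the_equality)
      show "i \<in> {1..n} \<and> x \<in> B i" using that by blast
      fix j
      assume j: "j \<in> {1..n} \<and> x \<in> B j"
      show "j = i"
      proof (rule ccontr)
        assume "j \<noteq> i"
        then have "B j \<inter> B i = {}"
          using assms(1) j \<open>i \<in> {1..n}\<close> unfolding block_system_def disjoint_family_on_def by blast
        then show False using j that by blast
      qed
    qed
    ultimately show ?thesis by (simp add: f_def)
  qed
  have bB: "bij_betw f (B i) (C i)" if "i \<in> {1..n}" for i
    using g[OF that] bij_betw_cong[of "B i" f "g i" "C i", OF fB[OF that]] by blast
  have bY: "bij_betw f Y Z"
    using h bij_betw_cong[of Y f h Z] unfolding f_def by simp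
  have bU: "bij_betw f (\<Union>i\<in>{1..n}. B i) (\<Union>i\<in>{1..n}. C i)"
    using assms(2) bB by (intro bij_betw_UNION_disjoint) (auto simp: block_system_def)
  have "bij_betw f ((\<Union>i\<in>{1..n}. B i) \<union> Y) ((\<Union>i\<in>{1..n}. C i) \<union> Z)"
    using assms(2) by (intro bij_betw_combine bU bY) (auto simp: block_system_def)
  with bB show ?thesis by (intro that) (auto simp: bij_betw_def)
qed

lemma inset_number_eq:
  assumes "block_system m n B Y"
  shows "card (insets n k B Y) = inset_number m n k"
proof -
  let ?X = "(\<Union>i\<in>{1..n}. B i) \<union> Y"
  let ?X' = "(\<Union>i\<in>{1..n}. std_block i) \<union> std_rest m"
  obtain f where f: "bij_betw f ?X ?X'"
    and fB: "\<And>i. i \<in> {1..n} \<Longrightarrow> f ` B i = std_block i"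
    using block_system_bij[OF assms block_system_std] by metis
  have P: "bij_betw ((`) f) (Pow ?X) (Pow ?X')"
    using f by (rule bij_betw_Pow)
  have hit: "f ` A \<inter> std_block i \<noteq> {} \<longleftrightarrow> A \<inter> B i \<noteq> {}"
    if "A \<subseteq> ?X" "i \<in> {1..n}" for A i
  proof -
    have "f ` (A \<inter> B i) = f ` A \<inter> f ` B i"
      using that by (intro inj_on_image_Int[OF bij_betw_imp_inj_on[OF f]]) auto
    then show ?thesis unfolding fB[OF that(2)] by (metis image_is_empty)
  qed
  have crd: "card (f ` A) = card A" if "A \<subseteq> ?X" for A
    by (rule card_image[OF inj_on_subset[OF bij_betw_imp_inj_on[OF f] that]])
  have "bij_betw ((`) f) (insets n k B Y) (insets n k std_block (std_rest m))"
    unfolding bij_betw_def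
  proof
    show "inj_on ((`) f) (insets n k B Y)"
      using P by (rule inj_on_subset[OF bij_betw_imp_inj_on]) (auto simp: insets_def)
    have eq: "A \<in> insets n k B Y \<longleftrightarrow> f ` A \<in> insets n k std_block (std_rest m)"
      if "A \<subseteq> ?X" for A
    proof -
      have "f ` A \<subseteq> ?X'" using image_mono[OF that, of f] bij_betw_imp_surj_on[OF f] by (rule subset_trans[OF _ equalityD1])
      then show ?thesis
        unfolding insets_def mem_Collect_eq crd[OF that] using that hit[OF that] by blast
    qed
    have sur: "A' \<in> (`) f ` insets n k B Y" if A': "A' \<in> insets n k std_block (std_rest m)" for A'
    proof -
      have "A' \<in> (`) f ` Pow ?X"
        using A' unfolding bij_betw_imp_surj_on[OF P] by (auto simp: insets_def)
      then obtain A where "A \<subseteq> ?X" and "A' = f ` A" by blast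
      then show ?thesis using A' eq[of A] by blast
    qed
    have sub: "A \<subseteq> ?X" if "A \<in> insets n k B Y" for A
      using that by (simp add: insets_def)
    have "f ` A \<in> insets n k std_block (std_rest m)" if "A \<in> insets n k B Y" for A
      using eq[OF sub[OF that]] that by (rule iffD1)
    then show "(`) f ` insets n k B Y = insets n k std_block (std_rest m)"
      using sur by (intro equalityI image_subsetI subsetI)
  qed
  then show ?thesis by (simp add: inset_number_def bij_betw_same_card)
qed

end

theory Submission
  imports Defs
begin

text \<open>
  Write \<open>N m n k\<close> for \<open>inset_number m n k\<close>. Splitting the insets by whether they contain
  a chosen element \<open>a\<close> of the last block \<open>{a, b}\<close> gives
  \<open>N m (n + 1) k = N (m + 1) n k + N m n k\<close> (\<open>inset_number_Suc\<close>): if \<open>a\<close> is taken, then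
  \<open>b\<close> becomes a free element of the rest; if not, then \<open>b\<close> is forced.
  On the other side, multiplying a power series by \<open>1 + x\<close> adds to each coefficient the preceding
  one. Since the index \<open>m + k - n\<close> drops by one when \<open>n\<close> grows by one, the two rules agree,
  and induction on \<open>n\<close> reduces the expansion to the negative binomial series
  \<open>1 / (1 - x)^(k + 1) = (\<Sum>m. (m + k choose k) x^m)\<close>, whose coefficients are \<open>N (m + k) 0 k\<close>.

  The one place where the rules could differ is the constant coefficient, which has no predecessor.
  The missing summand is then a number \<open>N m n k\<close> with \<open>m + n < k\<close>, and this vanishes because
  the ground set has only \<open>2 n + m < n + k\<close> elements.
\<close>

lemma inset_number_0: "inset_number m 0 k = m choose k"
proof -
  have "finite (std_rest m)" and "card (std_rest m) = m"
    using block_system_std[of m 0] by (simp_all add: block_system_def)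
  then show ?thesis
    using n_subsets[of "std_rest m" k] by (simp add: inset_number_def insets_def)
qed

lemma finite_std_blocks: "finite ((\<Union>i\<in>{1..n}. std_block i) \<union> std_rest m)"
  by (auto simp: std_block_def std_rest_def)

lemma inset_number_eq_0:
  assumes "m + n < k"
  shows "inset_number m n k = 0"
proof -
  let ?X = "(\<Union>i\<in>{1..n}. std_block i) \<union> std_rest m"
  have c: "card (std_block i) = 2" if "i \<in> {1..n}" for i
    using block_system_std[of m n] that by (simp add: block_system_def)
  have "card ?X \<le> card (\<Union>i\<in>{1..n}. std_block i) + card (std_rest m)"
    by (rule card_Un_le)
  also have "card (\<Union>i\<in>{1..n}. std_block i) \<le> (\<Sum>i\<in>{1..n}. card (std_block i))"
    by (rule card_UN_le) simp
  also have "\<dots> = 2 * n" using c by simp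
  also have "card (std_rest m) = m"
    using block_system_std[of m n] by (simp add: block_system_def)
  finally have "card ?X < n + k" using assms by simp
  moreover have "n + k \<le> card ?X" if "A \<in> insets n k std_block (std_rest m)" for A
    using that card_mono[OF finite_std_blocks[of n m], of A] by (simp add: insets_def)
  ultimately have "insets n k std_block (std_rest m) = {}" by fastforce
  then show ?thesis by (simp add: inset_number_def)
qed

text \<open>
  An inset either contains \<open>a\<close>, and then its remainder is an inset of the system in which the
  last block is dissolved and \<open>b\<close> joins the rest, or it avoids \<open>a\<close>, and then it must contain
  \<open>b\<close> and its remainder is an inset of the first \<open>n\<close> blocks.
\<close>

lemma insets_Suc:
  assumes B: "B (Suc n) = {a, b}" and ab: "a \<noteq> b"
    and fin: "finite ((\<Union>i\<in>{1..n}. B i) \<union> Y)"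
    and notin: "a \<notin> (\<Union>i\<in>{1..n}. B i) \<union> Y" "b \<notin> (\<Union>i\<in>{1..n}. B i) \<union> Y"
  shows "insets (Suc n) k B Y = insert a ` insets n k B (insert b Y) \<union> insert b ` insets n k B Y"
    (is "?L = ?R1 \<union> ?R2")
proof (intro equalityI subsetI)
  let ?U = "\<Union>i\<in>{1..n}. B i"
  have range: "{1..Suc n} = insert (Suc n) {1..n}" by auto
  fix A
  assume "A \<in> ?L"
  then have sub: "A \<subseteq> {a, b} \<union> ?U \<union> Y" and card: "card A = Suc (n + k)"
    and hit: "A \<inter> {a, b} \<noteq> {}" "\<And>i. i \<in> {1..n} \<Longrightarrow> A \<inter> B i \<noteq> {}"
    unfolding insets_def range by (auto simp: B)
  \<comment> \<open>\<open>a\<close> and \<open>b\<close> lie in none of the first \<open>n\<close> blocks, so removing them keeps these blocks hit.\<close>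
  have hit': "(A - {c}) \<inter> B i \<noteq> {}" if "c \<in> {a, b}" "i \<in> {1..n}" for c i
    using hit(2)[OF that(2)] notin that by blast
  show "A \<in> ?R1 \<union> ?R2"
  proof (cases "a \<in> A")
    case True
    have "card (A - {a}) = n + k" using True card by (simp add: card_Diff_singleton)
    moreover have "A - {a} \<subseteq> ?U \<union> insert b Y" using sub by blast
    ultimately have "A - {a} \<in> insets n k B (insert b Y)" using hit' by (simp add: insets_def)
    moreover have "A = insert a (A - {a})" using True by blast
    ultimately show ?thesis by blast
  next
    case False
    then have b: "b \<in> A" using hit(1) by blast
    have "card (A - {b}) = n + k" using b card by (simp add: card_Diff_singleton)
    moreover have "A - {b} \<subseteq> ?U \<union> Y" using sub False by blast
    ultimately have "A - {b} \<in> insets n k B Y" using hit' by (simp add: insets_def)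
    moreover have "A = insert b (A - {b})" using b by blast
    ultimately show ?thesis by blast
  qed
next
  let ?U = "\<Union>i\<in>{1..n}. B i"
  have range: "{1..Suc n} = insert (Suc n) {1..n}" by auto
  have extend: "insert c A \<in> ?L"
    if A: "A \<in> insets n k B Z" and Z: "Z \<subseteq> insert b Y" and c: "c \<in> {a, b}" "c \<notin> ?U \<union> Z" for c A Z
  proof -
    have sub: "A \<subseteq> ?U \<union> Z" and card: "card A = n + k" using A by (auto simp: insets_def)
    have "A \<subseteq> insert b (?U \<union> Y)" using sub Z by blast
    then have "finite A" using fin by (metis finite_insert finite_subset)
    moreover have "c \<notin> A" using c(2) sub by blast
    ultimately have "card (insert c A) = Suc n + k" using card by simp
    moreover have "insert c A \<subseteq> (\<Union>i\<in>{1..Suc n}. B i) \<union> Y"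
      using sub Z c(1) unfolding range by (auto simp: B)
    moreover have "insert c A \<inter> B i \<noteq> {}" if "i \<in> {1..Suc n}" for i
      using that A c(1) unfolding range by (auto simp: B insets_def)
    ultimately show ?thesis by (simp add: insets_def)
  qed
  fix A
  assume "A \<in> ?R1 \<union> ?R2"
  then show "A \<in> ?L"
  proof
    assume "A \<in> ?R1"
    then show ?thesis using extend[of _ "insert b Y" a] notin ab by auto
  next
    assume "A \<in> ?R2"
    then show ?thesis using extend[of _ Y b] notin by auto
  qed
qed

lemma inset_number_Suc:
  "inset_number m (Suc n) k = inset_number (Suc m) n k + inset_number m n k"
proof -
  let ?B = std_block and ?Y = "std_rest m"
  define a b :: "nat \<times> bool + nat" where "a = Inl (Suc n, False)" and "b = Inl (Suc n, True)"
  let ?U = "\<Union>i\<in>{1..n}. ?B i"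
  have B: "?B (Suc n) = {a, b}"
    by (auto simp: std_block_def a_def b_def UNIV_bool)
  have ab: "a \<noteq> b" by (simp add: a_def b_def)
  have notin: "a \<notin> ?U \<union> ?Y" "b \<notin> ?U \<union> ?Y"
    by (auto simp: std_block_def std_rest_def a_def b_def)
  let ?I = "insets n k ?B (insert b ?Y)" and ?J = "insets n k ?B ?Y"
  have a_I: "a \<notin> A" if "A \<in> ?I" for A using that notin ab by (auto simp: insets_def)
  have ab_J: "a \<notin> A" "b \<notin> A" if "A \<in> ?J" for A using that notin by (auto simp: insets_def)
  have "finite (Pow (insert b (?U \<union> ?Y)))" using finite_std_blocks[of n m] by simp
  then have fin: "finite ?I" "finite ?J"
    by (rule rev_finite_subset, auto simp: insets_def)+
  have "block_system (Suc m) n ?B (insert b ?Y)"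
    using block_system_std[of m n] notin by (auto simp: block_system_def)
  then have I: "card ?I = inset_number (Suc m) n k" by (rule inset_number_eq)
  have "inset_number m (Suc n) k = card (insert a ` ?I \<union> insert b ` ?J)"
    using insets_Suc[OF B ab finite_std_blocks notin] by (simp add: inset_number_def)
  also have "\<dots> = card (insert a ` ?I) + card (insert b ` ?J)"
    using fin ab ab_J by (intro card_Un_disjoint) auto
  also have "card (insert a ` ?I) = card ?I"
    using a_I by (intro card_image inj_onI) (metis insert_ident)
  also have "card (insert b ` ?J) = card ?J"
    using ab_J by (intro card_image inj_onI) (metis insert_ident)
  finally show ?thesis by (simp add: I inset_number_def)
qed

lemma fps_nth_one_plus_X_mult:
  fixes f :: "'a::comm_ring_1 fps"
  shows "fps_nth ((1 + fps_X) * f) m = fps_nth f m + (if m = 0 then 0 else fps_nth f (m - 1))"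
  by (simp add: distrib_right)

lemma fps_nth_inverse_one_minus_X_power:
  "fps_nth (inverse ((1 - fps_X :: 'a::field_char_0 fps) ^ Suc k)) m = of_nat (m + k choose k)"
proof -
  have "fps_nth (inverse ((1 - fps_X :: 'a fps) ^ Suc k)) m = of_nat (k + m choose m)"
    using one_minus_const_fps_X_neg_power'[of "Suc k" "1 :: 'a"] by simp
  also have "k + m choose m = m + k choose k"
    using binomial_symmetric[of m "k + m"] by (simp add: add.commute)
  finally show ?thesis .
qed

lemma fps_nth_inset_series:
  assumes "n \<le> m + k"
  shows "fps_nth ((1 + fps_X) ^ n * inverse ((1 - fps_X :: 'a::field_char_0 fps) ^ Suc k)) m =
    of_nat (inset_number (m + k - n) n k)"
  using assms
proof (induction n arbitrary: m)
  case 0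
  show ?case
    unfolding power_0 mult_1 fps_nth_inverse_one_minus_X_power by (simp add: inset_number_0)
next
  case (Suc n)
  let ?f = "(1 + fps_X) ^ n * inverse ((1 - fps_X :: 'a fps) ^ Suc k)"
  define r where "r = m + k - Suc n"
  have r: "m + k - n = Suc r" using Suc.prems by (simp add: r_def)
  have prev: "(if m = 0 then 0 else fps_nth ?f (m - 1)) = of_nat (inset_number r n k)"
  proof (cases "m = 0")
    case True
    \<comment> \<open>Here \<open>r = k - n - 1\<close>, so the ground set with \<open>2 n + r\<close> elements is one element too small.\<close>
    then have "r + n < k" using Suc.prems by (simp add: r_def)
    then show ?thesis using True by (simp add: inset_number_eq_0)
  next
    case False
    then have "n \<le> m - 1 + k" and "m - 1 + k - n = r"
      using Suc.prems by (simp_all add: r_def)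
    then show ?thesis using False Suc.IH[of "m - 1"] by simp
  qed
  have "fps_nth ((1 + fps_X) ^ Suc n * inverse ((1 - fps_X :: 'a fps) ^ Suc k)) m =
      fps_nth ?f m + (if m = 0 then 0 else fps_nth ?f (m - 1))"
    unfolding power_Suc[of "1 + fps_X"] mult.assoc by (rule fps_nth_one_plus_X_mult)
  also have "\<dots> = of_nat (inset_number (Suc r) n k) + of_nat (inset_number r n k)"
    using Suc.IH[of m] Suc.prems unfolding prev r by simp
  finally show ?case by (simp add: inset_number_Suc r_def)
qed

theorem proposition9:
  fixes n k m0 :: nat and F G :: "'a::field_char_0 fps"
  assumes m0: "int m0 = max 0 (int n - int k)"
    and F: "F = (1 + fps_X) ^ n / (1 - fps_X) ^ (k + 1)"
    and G: "G = Abs_fps (\<lambda>m. if m0 \<le> m then of_nat (inset_number (m + k - n) n k) else 0)"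
  shows "(\<forall>m. m + k \<ge> n \<longrightarrow> fps_nth F m = of_nat (inset_number (m + k - n) n k)) \<and>
         F = fps_cutoff m0 F + G \<and>
         (n \<le> k \<longrightarrow> F = G)"
proof -
  have "F = (1 + fps_X) ^ n * inverse ((1 - fps_X) ^ Suc k)"
    unfolding F by (simp add: fps_divide_unit)
  then have coeff: "fps_nth F m = of_nat (inset_number (m + k - n) n k)" if "n \<le> m + k" for m
    using fps_nth_inset_series[OF that] by simp
  have "m0 \<le> m \<longleftrightarrow> n \<le> m + k" for m using m0 by linarith
  then have G_nth: "fps_nth G m = (if m0 \<le> m then fps_nth F m else 0)" for m
    using coeff by (simp add: G)
  then have "F = fps_cutoff m0 F + G" by (simp add: fps_eq_iff)
  moreover have "F = G" if "n \<le> k"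
    using that m0 G_nth by (simp add: fps_eq_iff)
  ultimately show ?thesis using coeff by blast
qed

end
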